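(* Let $J$ be an infinite complex Jacobi matrix with diagonal entries $b_n$, superdiagonal entries $c_n$ and subdiagonal entries $a_n$ ($n\in\mathbb{N}$), satisfying the standing assumptions given in the context, and let $d_m=|b_m|+|1-a_{m-1}c_{m-1}|$ for $m\ge 1$, where $a_0=c_0=1$. Let $t\approx 0.567$ be the real root of $te^t=1$. (1) Suppose that $\sum_{m=1}^\infty d_m<\infty$ and put $$\Omega=\Big\{z\in\mathbb{D}\setminus\{0\}:\ |z-z^{-1}|>2t^{-1}\sum_{m=1}^\infty d_m\Big\},\qquad G(J)=\{z+z^{-1}:\ z\in\Omega\}.$$ Then $G(J)$ is free from the discrete spectrum of $J$, that is, $G(J)\cap\sigma_d(J)=\emptyset$. (2) If $\sum_{m=1}^\infty m\,d_m<t$, then $J$ has no discrete spectrum, that is, $\sigma_d(J)=\emptyset$.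
   Context: $\mathbb{N}=\{1,2,\dots\}$ and $\mathbb{D}=\{z\in\mathbb{C}:|z|<1\}$. The Jacobi matrix is $$J=\begin{pmatrix} b_1&c_1&&&\\ a_1&b_2&c_2&&\\ &a_2&b_3&c_3&\\ &&\ddots&\ddots&\ddots\end{pmatrix}$$ with complex entries, regarded as a bounded operator on $\ell^2(\mathbb{N})$, i.e. $(Jy)_m=a_{m-1}y_{m-1}+b_my_m+c_my_{m+1}$ for $m\ge 2$ and $(Jy)_1=b_1y_1+c_1y_2$. Standing assumptions: $a_nc_n\ne 0$ for all $n\in\mathbb{N}$; $\lim_{n\to\infty}a_n=\lim_{n\to\infty}c_n=1$ and $\lim_{n\to\infty}b_n=0$ (so $J$ is a compact perturbation of the discrete Laplacian $J_0$, which has $a_n=c_n=1$, $b_n=0$); and the infinite product $\prod_{i=1}^\infty a_i$ converges (to a nonzero limit). The convention $a_0=c_0=1$ is used. The spectrum of such an operator has the form $\sigma(J)=[-2,2]\cup\sigma_d(J)$, where the discrete spectrum $\sigma_d(J)=\sigma(J)\setminus[-2,2]$ is an at most countable set all of whose accumulation points lie in $[-2,2]$. *)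

theory Defs
  imports "HOL-Analysis.Analysis"
begin

text \<open>
  Indices follow the convention \<open>1, 2, 3, \<dots>\<close>.  A sequence on the positive integers is
  represented by a function on \<^typ>\<open>nat\<close> that vanishes at \<open>0\<close>, so the Hilbert space of
  square-summable sequences on the positive integers is the following carrier set.
\<close>

definition ell2 :: "(nat \<Rightarrow> complex) set" where
  "ell2 = {y. y 0 = 0 \<and> summable (\<lambda>n. (cmod (y n))\<^sup>2)}"

definition ell2_norm :: "(nat \<Rightarrow> complex) \<Rightarrow> real" where
  "ell2_norm y = sqrt (\<Sum>n. (cmod (y n))\<^sup>2)"

definition ell2_bounded_op :: "((nat \<Rightarrow> complex) \<Rightarrow> (nat \<Rightarrow> complex)) \<Rightarrow> bool" where
  "ell2_bounded_op T \<longleftrightarrow>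
     (\<forall>y\<in>ell2. T y \<in> ell2) \<and>
     (\<forall>x\<in>ell2. \<forall>y\<in>ell2. T (\<lambda>n. x n + y n) = (\<lambda>n. T x n + T y n)) \<and>
     (\<forall>k. \<forall>y\<in>ell2. T (\<lambda>n. k * y n) = (\<lambda>n. k * T y n)) \<and>
     (\<exists>K. \<forall>y\<in>ell2. ell2_norm (T y) \<le> K * ell2_norm y)"

text \<open>
  A point is outside the spectrum iff the shifted operator has a bounded, everywhere
  defined two-sided inverse.
\<close>

definition ell2_spectrum :: "((nat \<Rightarrow> complex) \<Rightarrow> (nat \<Rightarrow> complex)) \<Rightarrow> complex set" where
  "ell2_spectrum T = {w. \<not> (\<exists>R. ell2_bounded_op R \<and>
     (\<forall>y\<in>ell2. R (\<lambda>n. T y n - w * y n) = y) \<and>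
     (\<forall>y\<in>ell2. (\<lambda>n. T (R y) n - w * R y n) = y))}"

definition jacobi ::
    "(nat \<Rightarrow> complex) \<Rightarrow> (nat \<Rightarrow> complex) \<Rightarrow> (nat \<Rightarrow> complex) \<Rightarrow> (nat \<Rightarrow> complex) \<Rightarrow> nat \<Rightarrow> complex" where
  "jacobi a b c y m =
     (if m = 0 then 0
      else if m = 1 then b 1 * y 1 + c 1 * y 2
      else a (m - 1) * y (m - 1) + b m * y m + c m * y (m + 1))"

text \<open>
  For compact perturbations of the discrete Laplacian the essential spectrum is the
  interval \<open>[-2, 2]\<close>, and the discrete spectrum is what remains.
\<close>

definition jacobi_discrete_spectrum ::
    "(nat \<Rightarrow> complex) \<Rightarrow> (nat \<Rightarrow> complex) \<Rightarrow> (nat \<Rightarrow> complex) \<Rightarrow> complex set" where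
  "jacobi_discrete_spectrum a b c = ell2_spectrum (jacobi a b c) - complex_of_real ` {-2..2}"

text \<open>Only used for \<open>m \<ge> 1\<close>, with \<open>a 0 = c 0 = 1\<close>.\<close>

definition jacobi_d ::
    "(nat \<Rightarrow> complex) \<Rightarrow> (nat \<Rightarrow> complex) \<Rightarrow> (nat \<Rightarrow> complex) \<Rightarrow> nat \<Rightarrow> real" where
  "jacobi_d a b c m = cmod (b m) + cmod (1 - a (m - 1) * c (m - 1))"

definition jacobi_Omega ::
    "real \<Rightarrow> (nat \<Rightarrow> complex) \<Rightarrow> (nat \<Rightarrow> complex) \<Rightarrow> (nat \<Rightarrow> complex) \<Rightarrow> complex set" where
  "jacobi_Omega t a b c =
     {z \<in> ball 0 1 - {0}. cmod (z - inverse z) > 2 * inverse t * (\<Sum>m. jacobi_d a b c (Suc m))}"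

definition jacobi_G ::
    "real \<Rightarrow> (nat \<Rightarrow> complex) \<Rightarrow> (nat \<Rightarrow> complex) \<Rightarrow> (nat \<Rightarrow> complex) \<Rightarrow> complex set" where
  "jacobi_G t a b c = {z + inverse z | z. z \<in> jacobi_Omega t a b c}"

end

theory Submission
  imports Defs
begin

text \<open>
  Conjugating with the diagonal matrix of the partial products of the \<open>a\<^sub>i\<close>, which is bounded
  with bounded inverse, turns \<open>J\<close> into \<open>J\<^sub>0 + V\<close> with
  \<open>(V x)\<^sub>m = b\<^sub>m x\<^sub>m + (a\<^sub>m c\<^sub>m - 1) x\<^sub>m\<^sub>+\<^sub>1\<close>.  For \<open>\<lambda> = z + 1/z\<close> the resolvent kernel
  \<open>G(n, m)\<close> of \<open>J\<^sub>0\<close> is bounded both by \<open>2 / |z - 1/z|\<close> and by \<open>m\<close>.  Hence under either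
  hypothesis \<open>(J\<^sub>0 - \<lambda>)\<^sup>-\<^sup>1 V\<close> has norm less than \<open>1\<close> on bounded sequences, because
  \<open>t < 1\<close>, and \<open>x + (J\<^sub>0 - \<lambda>)\<^sup>-\<^sup>1 V x = (J\<^sub>0 - \<lambda>)\<^sup>-\<^sup>1 g\<close> is solvable by a contraction
  argument.  Since \<open>V\<close> maps bounded sequences to summable ones, bounded solutions are square summable
  when \<open>g\<close> is, with a norm estimate, so \<open>J - \<lambda>\<close> is boundedly invertible.
\<close>

section \<open>Norm estimates for square-summable sequences\<close>

lemma L2_set_le_ell2_norm:
  assumes "summable (\<lambda>n. (cmod (y n))\<^sup>2)"
  shows "L2_set (\<lambda>n. cmod (y n)) {..<N} \<le> ell2_norm y"
  unfolding L2_set_def ell2_norm_def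
  by (intro real_sqrt_le_mono sum_le_suminf assms) auto

lemma ell2I_bounded:
  assumes "\<And>N. L2_set (\<lambda>n. cmod (y n)) {..<N} \<le> K" "y 0 = 0"
  shows "y \<in> ell2" "ell2_norm y \<le> K"
proof -
  have K: "K \<ge> 0"
    using assms(1)[of 0] by simp
  have le: "(\<Sum>n<N. (cmod (y n))\<^sup>2) \<le> K\<^sup>2" for N
    using assms(1)[of N] by (simp add: L2_set_def real_sqrt_le_iff' sum_nonneg K sqrt_le_D)
  have sm: "summable (\<lambda>n. (cmod (y n))\<^sup>2)"
    by (rule summableI_nonneg_bounded[OF _ le]) simp
  then show "y \<in> ell2"
    using assms(2) by (simp add: ell2_def)
  have "(\<Sum>n. (cmod (y n))\<^sup>2) \<le> K\<^sup>2"
    by (rule suminf_le_const[OF sm le])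
  then show "ell2_norm y \<le> K"
    unfolding ell2_norm_def using K by (simp add: real_le_lsqrt)
qed

lemma ell2_zero: "y \<in> ell2 \<Longrightarrow> y 0 = 0"
  by (simp add: ell2_def)

lemma ell2_L2_set_le:
  "y \<in> ell2 \<Longrightarrow> L2_set (\<lambda>n. cmod (y n)) {..<N} \<le> ell2_norm y"
  by (rule L2_set_le_ell2_norm) (simp add: ell2_def)

lemma ell2_norm_nonneg: "y \<in> ell2 \<Longrightarrow> 0 \<le> ell2_norm y"
  using ell2_L2_set_le[of y 0] by simp

lemma cmod_le_ell2_norm:
  assumes "y \<in> ell2"
  shows "cmod (y n) \<le> ell2_norm y"
proof -
  have "cmod (y n) \<le> L2_set (\<lambda>n. cmod (y n)) {..<Suc n}"
    by (rule member_le_L2_set) auto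
  also have "\<dots> \<le> ell2_norm y"
    by (rule ell2_L2_set_le[OF assms])
  finally show ?thesis .
qed

text \<open>Minkowski's inequality on finite truncations, followed by the limit in
  \<open>ell2I_bounded\<close>. Sums, differences and bounded multipliers on \<open>ell2\<close> all
  reduce to this domination.\<close>

lemma ell2_dominated:
  assumes "x \<in> ell2" "y \<in> ell2" "0 \<le> A" "0 \<le> B" "z 0 = 0"
    and le: "\<And>n. cmod (z n) \<le> A * cmod (x n) + B * cmod (y n)"
  shows "z \<in> ell2" "ell2_norm z \<le> A * ell2_norm x + B * ell2_norm y"
proof -
  have "L2_set (\<lambda>n. cmod (z n)) {..<N} \<le> A * ell2_norm x + B * ell2_norm y" for N
  proof -
    have "L2_set (\<lambda>n. cmod (z n)) {..<N} \<le> L2_set (\<lambda>n. A * cmod (x n) + B * cmod (y n)) {..<N}"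
      by (rule L2_set_mono) (use le in auto)
    also have "\<dots> \<le> L2_set (\<lambda>n. A * cmod (x n)) {..<N} + L2_set (\<lambda>n. B * cmod (y n)) {..<N}"
      by (rule L2_set_triangle_ineq)
    also have "\<dots> = A * L2_set (\<lambda>n. cmod (x n)) {..<N} + B * L2_set (\<lambda>n. cmod (y n)) {..<N}"
      using assms(3,4) by (simp add: L2_set_right_distrib)
    also have "\<dots> \<le> A * ell2_norm x + B * ell2_norm y"
      by (intro add_mono mult_left_mono ell2_L2_set_le assms)
    finally show ?thesis .
  qed
  then show "z \<in> ell2" "ell2_norm z \<le> A * ell2_norm x + B * ell2_norm y"
    using ell2I_bounded[of z, OF _ assms(5)] by blast+
qed

lemma ell2_dominated1:
  assumes "x \<in> ell2" "0 \<le> A" "z 0 = 0" "\<And>n. cmod (z n) \<le> A * cmod (x n)"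
  shows "z \<in> ell2" "ell2_norm z \<le> A * ell2_norm x"
  using ell2_dominated[of x x A 0 z] assms by auto

lemma ell2_add:
  assumes "x \<in> ell2" "y \<in> ell2"
  shows "(\<lambda>n. x n + y n) \<in> ell2" "ell2_norm (\<lambda>n. x n + y n) \<le> ell2_norm x + ell2_norm y"
  using ell2_dominated[of x y 1 1 "\<lambda>n. x n + y n"] assms
  by (auto simp: ell2_zero norm_triangle_ineq)

lemma ell2_diff:
  assumes "x \<in> ell2" "y \<in> ell2"
  shows "(\<lambda>n. x n - y n) \<in> ell2" "ell2_norm (\<lambda>n. x n - y n) \<le> ell2_norm x + ell2_norm y"
  using ell2_dominated[of x y 1 1 "\<lambda>n. x n - y n"] assms
  by (auto simp: ell2_zero norm_triangle_ineq4)

lemma ell2_mult_bounded: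
  assumes "y \<in> ell2" "\<And>n. cmod (k n) \<le> K"
  shows "(\<lambda>n. k n * y n) \<in> ell2" "ell2_norm (\<lambda>n. k n * y n) \<le> K * ell2_norm y"
proof -
  have "0 \<le> K"
    using assms(2)[of 0] norm_ge_zero order_trans by blast
  then show "(\<lambda>n. k n * y n) \<in> ell2" "ell2_norm (\<lambda>n. k n * y n) \<le> K * ell2_norm y"
    using ell2_dominated1[of y K "\<lambda>n. k n * y n"] assms
    by (auto simp: ell2_zero norm_mult mult_right_mono)
qed

lemma ell2_if_summable:
  assumes "summable (\<lambda>n. cmod (y n))" "y 0 = 0"
  shows "y \<in> ell2" "ell2_norm y \<le> (\<Sum>n. cmod (y n))"
proof -
  have "L2_set (\<lambda>n. cmod (y n)) {..<N} \<le> (\<Sum>n. cmod (y n))" for N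
    by (rule order_trans[OF L2_set_le_sum sum_le_suminf]) (use assms in auto)
  then show "y \<in> ell2" "ell2_norm y \<le> (\<Sum>n. cmod (y n))"
    using ell2I_bounded[of y, OF _ assms(2)] by blast+
qed

section \<open>A sufficient condition for lying outside the spectrum\<close>

text \<open>The lower bound \<open>below\<close> makes T - w injective and \<open>onto\<close> makes
  it surjective on \<open>ell2\<close>, so it has an inverse there. Injectivity forces the inverse
  to be linear, and \<open>K\<close> bounds its norm.\<close>

lemma not_in_ell2_spectrumI:
  assumes T: "\<And>y. y \<in> ell2 \<Longrightarrow> T y \<in> ell2"
    and T_add: "\<And>x y. x \<in> ell2 \<Longrightarrow> y \<in> ell2 \<Longrightarrow> T (\<lambda>n. x n + y n) = (\<lambda>n. T x n + T y n)"
    and T_mult: "\<And>k y. y \<in> ell2 \<Longrightarrow> T (\<lambda>n. k * y n) = (\<lambda>n. k * T y n)"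
    and below: "\<And>y. y \<in> ell2 \<Longrightarrow> ell2_norm y \<le> K * ell2_norm (\<lambda>n. T y n - w * y n)"
    and onto: "\<And>g. g \<in> ell2 \<Longrightarrow> \<exists>y\<in>ell2. (\<lambda>n. T y n - w * y n) = g"
  shows "w \<notin> ell2_spectrum T"
proof -
  define S where "S y = (\<lambda>n. T y n - w * y n)" for y
  \<comment> \<open>Values of \<open>R\<close> outside \<open>ell2\<close> are arbitrary;
    \<open>ell2_bounded_op\<close> and \<open>ell2_spectrum\<close> only test arguments in
    \<open>ell2\<close>.\<close>
  define R where "R g = (SOME y. y \<in> ell2 \<and> S y = g)" for g
  have S_ell2: "S y \<in> ell2" if "y \<in> ell2" for y
    unfolding S_def using that by (intro ell2_diff T ell2_mult_bounded(1)[of y "\<lambda>_. w"]) auto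
  have S_add: "S (\<lambda>n. x n + y n) = (\<lambda>n. S x n + S y n)" if "x \<in> ell2" "y \<in> ell2" for x y
    unfolding S_def using that by (auto simp: T_add algebra_simps)
  have S_mult: "S (\<lambda>n. k * y n) = (\<lambda>n. k * S y n)" if "y \<in> ell2" for k y
    unfolding S_def using that by (auto simp: T_mult algebra_simps)
  have mult_ell2: "(\<lambda>n. k * y n) \<in> ell2" if "y \<in> ell2" for k y
    using that by (intro ell2_mult_bounded(1)[of y "\<lambda>_. k"]) auto
  have inj: "x = y" if "x \<in> ell2" "y \<in> ell2" "S x = S y" for x y
  proof -
    define u where "u = (\<lambda>n. x n + (-1) * y n)"
    have u: "u \<in> ell2"
      unfolding u_def by (intro ell2_add mult_ell2 that)
    have "S u = (\<lambda>n. 0)"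
      unfolding u_def using that by (simp only: S_add S_mult mult_ell2) auto
    then have "ell2_norm u \<le> 0"
      using below[OF u] by (simp add: S_def[symmetric] ell2_norm_def)
    then have "cmod (u n) \<le> 0" for n
      using cmod_le_ell2_norm[OF u, of n] by linarith
    then show ?thesis
      by (auto simp: u_def fun_eq_iff)
  qed
  have R: "R g \<in> ell2 \<and> S (R g) = g" if "g \<in> ell2" for g
  proof -
    have "\<exists>y. y \<in> ell2 \<and> S y = g"
      using onto[OF that] unfolding S_def by blast
    then show ?thesis
      unfolding R_def by (rule someI_ex)
  qed
  have R_eq: "R (S y) = y" if "y \<in> ell2" for y
    using that R S_ell2 inj by blast
  have "R (\<lambda>n. x n + y n) = (\<lambda>n. R x n + R y n)" if "x \<in> ell2" "y \<in> ell2" for x y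
    using R_eq[of "\<lambda>n. R x n + R y n"] R[OF that(1)] R[OF that(2)]
    by (simp add: S_add ell2_add)
  moreover have "R (\<lambda>n. k * y n) = (\<lambda>n. k * R y n)" if "y \<in> ell2" for k y
    using R_eq[of "\<lambda>n. k * R y n"] R[OF that] by (simp add: S_mult mult_ell2)
  moreover have "ell2_norm (R y) \<le> K * ell2_norm y" if "y \<in> ell2" for y
    using below[of "R y"] R[OF that] by (simp add: S_def[symmetric])
  ultimately have "ell2_bounded_op R"
    unfolding ell2_bounded_op_def using R by blast
  moreover have "(\<lambda>n. T (R y) n - w * R y n) = y" if "y \<in> ell2" for y
    using R[OF that] by (simp add: S_def)
  moreover have "R (\<lambda>n. T y n - w * y n) = y" if "y \<in> ell2" for y
    using R_eq[OF that] by (simp add: S_def)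
  ultimately show ?thesis
    unfolding ell2_spectrum_def by blast
qed

section \<open>Bounded solutions of the free recurrence\<close>

text \<open>With y 0 = 0 the homogeneous solutions are multiples of z^n - z^(-n), which boundedness
  excludes. The bound \<open>B\<close> makes a supremum finite and then drops out of the final
  estimate.\<close>

lemma bounded_solution_ell2:
  fixes z :: complex
  assumes z: "z \<noteq> 0" "cmod z < 1"
    and y: "y 0 = 0" "\<And>n. cmod (y n) \<le> B"
    and g: "g \<in> ell2"
    and eq: "\<And>n. y (Suc (Suc n)) + y n - (z + inverse z) * y (Suc n) = g (Suc n)"
  shows "y \<in> ell2" "ell2_norm y \<le> 1 / (1 - cmod z)\<^sup>2 * ell2_norm g"
proof -
  let ?r = "cmod z" and ?G = "ell2_norm g"
  \<comment> \<open>\<open>J\<^sub>0 - (z + 1/z)\<close> is, up to the factor \<open>-1/z\<close>, the product \<open>(1 - z S\<^sup>*) (1 - z S)\<close> with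
    \<open>S\<close> the shift; both factors are inverted by a contraction argument.\<close>
  define h where "h n = y (Suc n) - z * y n" for n
  define A where "A N = L2_set (\<lambda>n. cmod (h n)) {..<N}" for N
  have r: "0 \<le> ?r" "?r < 1"
    using z by auto
  have B: "0 \<le> B"
    using y(2)[of 0] norm_ge_zero order_trans by blast
  have h_rec: "h n = z * h (Suc n) + (- z) * g (Suc n)" for n
    unfolding h_def eq[of n, symmetric] using z by (simp add: field_simps)
  have L2_Suc: "L2_set (\<lambda>n. cmod (f (Suc n))) {..<N} \<le> L2_set (\<lambda>n. cmod (f n)) {..<Suc N}" for f :: "nat \<Rightarrow> complex" and N
    unfolding L2_set_def sum.lessThan_Suc_shift by simp
  have L2_lincomb: "L2_set (\<lambda>n. cmod (p * f n + q * k n)) {..<N} \<le>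
      cmod p * L2_set (\<lambda>n. cmod (f n)) {..<N} + cmod q * L2_set (\<lambda>n. cmod (k n)) {..<N}"
    for p q :: complex and f k :: "nat \<Rightarrow> complex" and N
  proof -
    have "L2_set (\<lambda>n. cmod (p * f n + q * k n)) {..<N} \<le>
        L2_set (\<lambda>n. cmod p * cmod (f n) + cmod q * cmod (k n)) {..<N}"
      by (rule L2_set_mono) (auto simp: norm_mult intro: order_trans[OF norm_triangle_ineq])
    also have "\<dots> \<le> cmod p * L2_set (\<lambda>n. cmod (f n)) {..<N} + cmod q * L2_set (\<lambda>n. cmod (k n)) {..<N}"
      by (rule order_trans[OF L2_set_triangle_ineq]) (simp add: L2_set_right_distrib)
    finally show ?thesis .
  qed
  \<comment> \<open>The recursion \<open>h_rec\<close> expresses \<open>h n\<close> by its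
    successor, so truncation at N involves truncation at N + 1.\<close>
  have A_Suc: "A N \<le> ?r * A (Suc N) + ?r * ?G" for N
  proof -
    have "A N = L2_set (\<lambda>n. cmod (z * h (Suc n) + (- z) * g (Suc n))) {..<N}"
      unfolding A_def by (subst h_rec) simp
    also have "\<dots> \<le> ?r * L2_set (\<lambda>n. cmod (h (Suc n))) {..<N} + ?r * L2_set (\<lambda>n. cmod (g (Suc n))) {..<N}"
      using L2_lincomb[of z "\<lambda>n. h (Suc n)" "- z" "\<lambda>n. g (Suc n)" N] by simp
    also have "\<dots> \<le> ?r * A (Suc N) + ?r * ?G"
      unfolding A_def using L2_Suc[of h N] L2_Suc[of g N] ell2_L2_set_le[OF g, of "Suc N"]
      by (intro add_mono mult_left_mono) auto
    finally show ?thesis .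
  qed
  have h_bound: "cmod (h n) \<le> 2 * B" for n
  proof -
    have "cmod (h n) \<le> cmod (y (Suc n)) + ?r * cmod (y n)"
      unfolding h_def by (metis norm_mult norm_triangle_ineq4)
    also have "\<dots> \<le> B + 1 * B"
      by (intro add_mono mult_mono y) (use z in auto)
    finally show ?thesis by simp
  qed
  have "A N \<le> (?r * (2 * B) + ?r * ?G) / (1 - ?r)" for N
  proof -
    \<comment> \<open>One more coordinate costs at most 2 B, which turns \<open>A_Suc\<close> into a
      bound on \<open>A N\<close> independent of N. Only finiteness of the supremum is taken from
      it; the estimate without B comes from applying \<open>A_Suc\<close> to the supremum
      \<open>H\<close>.\<close>
    have "A (Suc N) \<le> A N + cmod (h N)"
      unfolding A_def by (simp add: lessThan_Suc L2_set_insert)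
        (metis abs_norm_cancel add.commute sqrt_sum_squares_le_sum_abs abs_of_nonneg L2_set_nonneg)
    then have "?r * A (Suc N) \<le> ?r * (A N + 2 * B)"
      using h_bound[of N] by (intro mult_left_mono) auto
    with A_Suc[of N] have "A N * (1 - ?r) \<le> ?r * (2 * B) + ?r * ?G"
      by (simp add: algebra_simps)
    then show ?thesis
      using r by (simp add: field_simps)
  qed
  then have bdd: "bdd_above (range A)"
    by (intro bdd_aboveI2)
  define H where "H = (SUP N. A N)"
  have A_le: "A N \<le> H" for N
    unfolding H_def by (rule cSUP_upper[OF _ bdd]) simp
  have "H \<le> ?r * H + ?r * ?G"
    unfolding H_def
  proof (rule cSUP_least)
    show "A N \<le> ?r * (SUP N. A N) + ?r * ?G" for N
      using A_Suc[of N] mult_left_mono[OF A_le[of "Suc N"] r(1)] unfolding H_def by linarith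
  qed simp
  then have H: "H * (1 - ?r) \<le> ?r * ?G"
    by (simp add: algebra_simps)
  have G0: "0 \<le> ?G"
    by (rule ell2_norm_nonneg[OF g])
  have y_le: "L2_set (\<lambda>n. cmod (y n)) {..<N} \<le> 1 / (1 - ?r)\<^sup>2 * ?G" for N
  proof -
    let ?Y = "L2_set (\<lambda>n. cmod (y n)) {..<N}"
    have "?Y \<le> L2_set (\<lambda>n. cmod (y n)) {..<Suc N}"
      unfolding L2_set_def by (intro real_sqrt_le_mono sum_mono2) auto
    \<comment> \<open>Since y 0 = 0, the first term disappears. After reindexing, \<open>?Y\<close>
      occurs on both sides, with factor |z| < 1 on the right.\<close>
    also have "\<dots> = L2_set (\<lambda>n. cmod (1 * h n + z * y n)) {..<N}"
      unfolding L2_set_def h_def by (subst sum.lessThan_Suc_shift) (simp add: y)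
    also have "\<dots> \<le> A N + ?r * ?Y"
      using L2_lincomb[of 1 h z y N] by (simp add: A_def)
    finally have "?Y * (1 - ?r) \<le> H"
      using A_le[of N] by (simp add: algebra_simps)
    then have "?Y * (1 - ?r) * (1 - ?r) \<le> H * (1 - ?r)"
      using r by (intro mult_right_mono) auto
    also have "\<dots> \<le> 1 * ?G"
      using H mult_right_mono[of ?r 1 ?G] r G0 by linarith
    finally have "?Y * (1 - ?r)\<^sup>2 \<le> ?G"
      by (simp add: power2_eq_square mult.assoc)
    then show ?thesis
      using r by (simp add: pos_le_divide_eq)
  qed
  show "y \<in> ell2" "ell2_norm y \<le> 1 / (1 - ?r)\<^sup>2 * ?G"
    using ell2I_bounded[OF y_le] y by auto
qed

text \<open>The difference of the two is a bounded solution with right-hand side 0, so the norm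
  estimate makes it vanish.\<close>

lemma bounded_solution_unique:
  fixes z :: complex
  assumes z: "z \<noteq> 0" "cmod z < 1"
    and x: "x 0 = 0" "\<And>n. cmod (x n) \<le> A"
    and y: "y 0 = 0" "\<And>n. cmod (y n) \<le> B"
    and eq: "\<And>n. x (Suc (Suc n)) + x n - (z + inverse z) * x (Suc n) =
      y (Suc (Suc n)) + y n - (z + inverse z) * y (Suc n)"
  shows "x = y"
proof -
  have "cmod (x n - y n) \<le> A + B" for n
    by (intro order_trans[OF norm_triangle_ineq4] add_mono assms)
  moreover have "(\<lambda>n. 0) \<in> ell2" "ell2_norm (\<lambda>n. 0) = 0"
    by (auto simp: ell2_def ell2_norm_def)
  moreover have "x (Suc (Suc n)) - y (Suc (Suc n)) + (x n - y n)
      - (z + inverse z) * (x (Suc n) - y (Suc n)) = 0" for n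
    using eq[of n] by (simp add: algebra_simps)
  ultimately have "(\<lambda>n. x n - y n) \<in> ell2 \<and> ell2_norm (\<lambda>n. x n - y n) \<le> 0"
    using bounded_solution_ell2[OF z, of "\<lambda>n. x n - y n" "A + B" "\<lambda>n. 0"] x(1) y(1) by simp
  then have "cmod (x n - y n) \<le> 0" for n
    using cmod_le_ell2_norm order_trans by meson
  then show ?thesis
    by (auto simp: fun_eq_iff)
qed

section \<open>Green kernel and resolvent of the free Jacobi matrix\<close>

text \<open>The Green kernel (z^|n-m| - z^(n+m)) / (z - 1/z) of the free operator at z + 1/z.
  Truncated subtraction encodes |n - m|; the mirror term z^(n+m) produces the boundary value 0 at
  index 0.\<close>

definition free_kernel :: "complex \<Rightarrow> nat \<Rightarrow> nat \<Rightarrow> complex" where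
  "free_kernel z n m = z ^ (n - m + (m - n)) * (1 - z ^ (2 * min n m)) / (z - inverse z)"

lemma free_kernel_0 [simp]: "free_kernel z n 0 = 0" "free_kernel z 0 n = 0"
  by (simp_all add: free_kernel_def)

lemma cmod_free_kernel_decay:
  assumes "cmod z < 1"
  shows "cmod (free_kernel z n m) \<le> 2 / cmod (z - inverse z) * cmod z ^ (n - m + (m - n))"
proof -
  have "cmod (1 - z ^ (2 * min n m)) \<le> 1 + cmod z ^ (2 * min n m)"
    using norm_triangle_ineq4[of 1 "z ^ (2 * min n m)"] by (simp add: norm_power)
  also have "\<dots> \<le> 2"
    using assms by (simp add: power_le_one)
  finally have "cmod z ^ (n - m + (m - n)) * cmod (1 - z ^ (2 * min n m)) / cmod (z - inverse z)
      \<le> cmod z ^ (n - m + (m - n)) * 2 / cmod (z - inverse z)"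
    by (intro divide_right_mono mult_left_mono) auto
  then show ?thesis
    by (simp add: free_kernel_def norm_mult norm_divide norm_power mult.commute)
qed

lemma cmod_free_kernel_le:
  assumes "cmod z < 1"
  shows "cmod (free_kernel z n m) \<le> 2 / cmod (z - inverse z)"
proof -
  have "cmod (free_kernel z n m) \<le> 2 / cmod (z - inverse z) * cmod z ^ (n - m + (m - n))"
    by (rule cmod_free_kernel_decay[OF assms])
  also have "\<dots> \<le> 2 / cmod (z - inverse z) * 1"
    using assms by (intro mult_left_mono power_le_one) auto
  finally show ?thesis by simp
qed

lemma inverse_diff_nonzero:
  fixes z :: complex
  assumes "z \<noteq> 0" "cmod z < 1"
  shows "z - inverse z \<noteq> 0"
proof
  assume "z - inverse z = 0"
  then have "cmod z = inverse (cmod z)"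
    by (simp flip: norm_inverse)
  then have "cmod z * cmod z = 1"
    using assms by (simp add: field_simps)
  then show False
    using assms by (simp add: abs_square_eq_1 flip: power2_eq_square)
qed

text \<open>Summing the geometric series cancels z - 1/z and leaves min(n, m) terms of modulus at
  most 1. The bound is uniform in z, also near 1 and -1, where 2/|z - 1/z| blows up.\<close>

lemma cmod_free_kernel_le_index:
  assumes z: "z \<noteq> 0" "cmod z < 1"
  shows "cmod (free_kernel z n m) \<le> real m"
proof -
  let ?k = "min n m"
  have nz: "z - inverse z \<noteq> 0"
    by (rule inverse_diff_nonzero[OF z])
  have "1 - z ^ (2 * ?k) = (1 - z\<^sup>2) * (\<Sum>i<?k. (z\<^sup>2) ^ i)"
    unfolding power_mult by (rule one_diff_power_eq)
  also have "1 - z\<^sup>2 = (z - inverse z) * (- z)"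
    using z by (simp add: field_simps power2_eq_square)
  finally have "free_kernel z n m = z ^ (n - m + (m - n)) * (- z * (\<Sum>i<?k. (z\<^sup>2) ^ i))"
    using nz by (simp add: free_kernel_def)
  then have "cmod (free_kernel z n m) = cmod z ^ (n - m + (m - n)) * (cmod z * cmod (\<Sum>i<?k. (z\<^sup>2) ^ i))"
    by (simp add: norm_mult norm_power)
  also have "\<dots> \<le> 1 * (1 * cmod (\<Sum>i<?k. (z\<^sup>2) ^ i))"
    using z by (intro mult_mono power_le_one) auto
  also have "\<dots> \<le> (\<Sum>i<?k. cmod ((z\<^sup>2) ^ i))"
    by (simp add: norm_sum)
  also have "\<dots> \<le> (\<Sum>i<?k. 1)"
    using z by (intro sum_mono) (auto simp: norm_power intro!: power_le_one)
  finally show ?thesis by simp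
qed

text \<open>Unless m = n + 1, all three values lie on one branch of the kernel, a combination of z^n
  and z^(-n), which solves the homogeneous recurrence. On the diagonal the numerators leave z - 1/z,
  which the denominator normalises to 1.\<close>

lemma free_kernel_eq:
  assumes z: "z \<noteq> 0" "cmod z < 1"
  shows "free_kernel z (Suc (Suc n)) m + free_kernel z n m
      - (z + inverse z) * free_kernel z (Suc n) m = (if m = Suc n then 1 else 0)"
proof -
  let ?K = "\<lambda>n m. z ^ (n - m + (m - n)) * (1 - z ^ (2 * min n m))"
  have nz: "z - inverse z \<noteq> 0"
    by (rule inverse_diff_nonzero[OF z])
  have "?K (Suc (Suc n)) m + ?K n m - (z + inverse z) * ?K (Suc n) m =
      (if m = Suc n then z - inverse z else 0)"
  proof (cases m "Suc n" rule: linorder_cases)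
    case less
    then obtain k where "n = m + k"
      using less_Suc_eq_le nat_le_iff_add by blast
    then show ?thesis
      using z by (simp add: min_def field_simps)
  next
    case equal
    then show ?thesis
      using z by (simp add: min_def field_simps)
  next
    case greater
    then obtain k where "m = Suc (Suc n) + k"
      using Suc_leI nat_le_iff_add by blast
    then show ?thesis
      using z by (simp add: min_def field_simps)
  qed
  then show ?thesis
    unfolding free_kernel_def using nz
    by (auto simp add: diff_divide_distrib[symmetric] add_divide_distrib[symmetric]) 
qed

text \<open>A two-sided geometric series centred at n, split at m = n; each half is at most 1/(1 -
  r).\<close>

lemma power_dist_sum_le:
  fixes r :: real
  assumes "0 \<le> r" "r < 1"
  shows "summable (\<lambda>m. r ^ (n - m + (m - n)))" "(\<Sum>m. r ^ (n - m + (m - n))) \<le> 2 / (1 - r)"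
proof -
  have geo: "summable (\<lambda>m. r ^ m)" "(\<Sum>m. r ^ m) = 1 / (1 - r)"
    using assms by (auto simp: suminf_geometric)
  have shift: "(\<lambda>m. r ^ (n - (m + n) + (m + n - n))) = (\<lambda>m. r ^ m)"
    by auto
  show sm: "summable (\<lambda>m. r ^ (n - m + (m - n)))"
    using geo(1) by (subst summable_iff_shift[of _ n, symmetric]) (simp add: shift)
  \<comment> \<open>Lowering the exponent by one only enlarges the terms and turns the sum into a
    reversed initial segment of the geometric series.\<close>
  have "(\<Sum>m<n. r ^ (n - m + (m - n))) \<le> (\<Sum>m<n. r ^ (n - Suc m))"
    by (intro sum_mono power_decreasing) (use assms in auto)
  also have "\<dots> = (\<Sum>m<n. r ^ m)"
    by (rule sum.nat_diff_reindex)
  also have "\<dots> \<le> 1 / (1 - r)"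
    unfolding geo(2)[symmetric] by (rule sum_le_suminf) (use assms geo in auto)
  finally show "(\<Sum>m. r ^ (n - m + (m - n))) \<le> 2 / (1 - r)"
    using suminf_split_initial_segment[OF sm, of n] geo(2) by (simp add: shift add_divide_distrib[symmetric])
qed

definition free_resolvent :: "complex \<Rightarrow> (nat \<Rightarrow> complex) \<Rightarrow> nat \<Rightarrow> complex" where
  "free_resolvent z g n = (\<Sum>m. free_kernel z n m * g m)"

text \<open>Decay of the kernel off the diagonal makes the series converge for every bounded g, with
  a bound independent of n.\<close>

lemma free_kernel_summable_bounded:
  assumes z: "cmod z < 1" and g: "\<And>m. cmod (g m) \<le> B"
  shows "summable (\<lambda>m. cmod (free_kernel z n m * g m))"
    and "cmod (free_resolvent z g n) \<le> 2 / cmod (z - inverse z) * B * (2 / (1 - cmod z))"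
proof -
  let ?e = "\<lambda>m. cmod z ^ (n - m + (m - n))" and ?C = "2 / cmod (z - inverse z) * B"
  have B: "0 \<le> B"
    using g[of 0] norm_ge_zero order_trans by blast
  have le: "cmod (free_kernel z n m * g m) \<le> ?C * ?e m" for m
  proof -
    have "cmod (free_kernel z n m) * cmod (g m) \<le> (2 / cmod (z - inverse z) * ?e m) * B"
      by (intro mult_mono cmod_free_kernel_decay z g) auto
    then show ?thesis
      by (simp add: norm_mult mult_ac)
  qed
  have e: "summable ?e" "suminf ?e \<le> 2 / (1 - cmod z)"
    using power_dist_sum_le[of "cmod z" n] z by auto
  show sm: "summable (\<lambda>m. cmod (free_kernel z n m * g m))"
    by (rule summable_comparison_test'[OF summable_mult[OF e(1), of ?C]]) (use le in auto)
  have "cmod (free_resolvent z g n) \<le> (\<Sum>m. cmod (free_kernel z n m * g m))"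
    unfolding free_resolvent_def by (rule summable_norm[OF sm])
  also have "\<dots> \<le> (\<Sum>m. ?C * ?e m)"
    by (rule suminf_le[OF le sm summable_mult[OF e(1)]])
  also have "\<dots> = ?C * suminf ?e"
    by (rule suminf_mult[OF e(1)])
  also have "\<dots> \<le> ?C * (2 / (1 - cmod z))"
    using e(2) B by (intro mult_left_mono) auto
  finally show "cmod (free_resolvent z g n) \<le> ?C * (2 / (1 - cmod z))" .
qed

lemma free_resolvent_diff:
  assumes z: "cmod z < 1" and "\<And>m. cmod (f m) \<le> A" "\<And>m. cmod (g m) \<le> B"
  shows "free_resolvent z (\<lambda>m. f m - g m) n = free_resolvent z f n - free_resolvent z g n"
  unfolding free_resolvent_def
  using suminf_diff[OF summable_norm_cancel[OF free_kernel_summable_bounded(1)[of z f A n]]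
      summable_norm_cancel[OF free_kernel_summable_bounded(1)[of z g B n]]] assms
  by (simp add: algebra_simps)

lemma free_resolvent_0 [simp]: "free_resolvent z g 0 = 0"
  by (simp add: free_resolvent_def)

lemma free_resolvent_eq:
  assumes z: "z \<noteq> 0" "cmod z < 1" and g: "\<And>m. cmod (g m) \<le> B"
  shows "free_resolvent z g (Suc (Suc n)) + free_resolvent z g n
      - (z + inverse z) * free_resolvent z g (Suc n) = g (Suc n)"
proof -
  have s: "(\<lambda>m. free_kernel z k m * g m) sums free_resolvent z g k" for k
    unfolding free_resolvent_def
    by (intro summable_sums summable_norm_cancel[OF free_kernel_summable_bounded(1)[OF z(2) g]])
  have "(\<lambda>m. free_kernel z (Suc (Suc n)) m * g m + free_kernel z n m * g m
      - (z + inverse z) * (free_kernel z (Suc n) m * g m)) sums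
      (free_resolvent z g (Suc (Suc n)) + free_resolvent z g n
      - (z + inverse z) * free_resolvent z g (Suc n))"
    by (intro sums_add sums_diff sums_mult s)
  moreover have "(\<lambda>m. free_kernel z (Suc (Suc n)) m * g m + free_kernel z n m * g m
      - (z + inverse z) * (free_kernel z (Suc n) m * g m)) =
      (\<lambda>m. if m = Suc n then g m else 0)"
  proof
    fix m
    show "free_kernel z (Suc (Suc n)) m * g m + free_kernel z n m * g m
      - (z + inverse z) * (free_kernel z (Suc n) m * g m) = (if m = Suc n then g m else 0)"
      using arg_cong[OF free_kernel_eq[OF z, of n m], of "\<lambda>x. x * g m"]
      by (auto simp: algebra_simps)
  qed
  moreover have "(\<lambda>m. if m = Suc n then g m else 0) sums g (Suc n)"
    using sums_single[of "Suc n" g] by simp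
  ultimately show ?thesis
    using sums_unique2 by metis
qed

section \<open>Fixed points of contractions on bounded functions\<close>

text \<open>Banach's fixed point theorem in the sup norm, proved by Picard iteration from 0.
  Boundedness is carried by explicit bounds, so \<open>F\<close> may behave arbitrarily on unbounded
  functions.\<close>

lemma bounded_contraction_fixpoint:
  fixes F :: "('a \<Rightarrow> 'b::banach) \<Rightarrow> 'a \<Rightarrow> 'b"
  assumes q: "0 \<le> q" "q < 1"
    and F_bounded: "\<And>x X. (\<And>n. norm (x n) \<le> X) \<Longrightarrow> \<exists>Y. \<forall>n. norm (F x n) \<le> Y"
    and F_contr: "\<And>x y X Y D n. \<lbrakk>\<And>n. norm (x n) \<le> X; \<And>n. norm (y n) \<le> Y; \<And>n. norm (x n - y n) \<le> D\<rbrakk>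
      \<Longrightarrow> norm (F x n - F y n) \<le> q * D"
  obtains x X where "F x = x" "\<And>n. norm (x n) \<le> X"
proof -
  define p where "p k = (F ^^ k) (\<lambda>_. 0)" for k
  have p_Suc: "p (Suc k) = F (p k)" for k
    by (simp add: p_def)
  have "\<exists>B. \<forall>n. norm (p k n) \<le> B" for k
  proof (induction k)
    case 0
    then show ?case by (auto simp: p_def)
  next
    case (Suc k)
    then show ?case using F_bounded[of "p k"] by (auto simp: p_Suc)
  qed
  then obtain B where B: "\<And>k n. norm (p k n) \<le> B k"
    by metis
  \<comment> \<open>The iteration starts at 0, so \<open>B 1\<close> bounds the first
    increment.\<close>
  have step: "norm (p (Suc k) n - p k n) \<le> B 1 * q ^ k" for k n
  proof (induction k arbitrary: n)
    case 0
    then show ?case using B[of 1 n] by (simp add: p_def)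
  next
    case (Suc k)
    have "norm (F (p (Suc k)) n - F (p k) n) \<le> q * (B 1 * q ^ k)"
      by (rule F_contr[OF B B Suc])
    then show ?case by (simp add: p_Suc[symmetric] mult_ac)
  qed
  define x where "x n = (\<Sum>k. p (Suc k) n - p k n)" for n
  have geo: "summable (\<lambda>k. B 1 * q ^ k)"
    using q by (intro summable_mult summable_geometric) auto
  \<comment> \<open>Convergence must be uniform, since \<open>F_contr\<close> asks for one bound
    \<open>D\<close> on the differences at all indices.\<close>
  have "uniform_limit UNIV (\<lambda>k n. \<Sum>i<k. p (Suc i) n - p i n) x sequentially"
    unfolding x_def by (rule Weierstrass_m_test[OF step geo])
  moreover have "(\<Sum>i<k. p (Suc i) n - p i n) = p k n" for k n
    by (subst sum_lessThan_telescope) (simp add: p_def)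
  ultimately have lim: "uniform_limit UNIV p x sequentially"
    by simp
  have x_bound: "norm (x n) \<le> (\<Sum>k. B 1 * q ^ k)" for n
    unfolding x_def by (rule norm_suminf_le[OF step geo])
  have "F x n = x n" for n
  proof (rule LIMSEQ_unique)
    show "(\<lambda>k. p (Suc k) n) \<longlonglongrightarrow> x n"
      using tendsto_uniform_limitI[OF lim, of n] by (intro LIMSEQ_Suc) simp
    show "(\<lambda>k. p (Suc k) n) \<longlonglongrightarrow> F x n"
    proof (rule tendstoI)
      fix e :: real assume "0 < e"
      with lim have "\<forall>\<^sub>F k in sequentially. \<forall>n\<in>UNIV. dist (p k n) (x n) < e"
        by (rule uniform_limitD)
      then show "\<forall>\<^sub>F k in sequentially. dist (p (Suc k) n) (F x n) < e"
      proof eventually_elim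
        case (elim k)
        then have "norm (F (p k) n - F x n) \<le> q * e"
          by (intro F_contr[OF B x_bound]) (auto simp: dist_norm less_imp_le)
        also have "\<dots> < e"
          using q \<open>0 < e\<close> by simp
        finally show ?case
          by (simp add: p_Suc dist_norm)
      qed
    qed
  qed
  then show thesis
    using that x_bound by blast
qed

section \<open>Small perturbations of the free operator\<close>

text \<open>The weight \<open>\<kappa>\<close> stays abstract so that one argument serves both the
  constant bound 2/|z - 1/z| and the bound m. The perturbation has diagonal \<open>\<beta>\<close>
  and superdiagonal \<open>\<epsilon>\<close>.\<close>

locale small_perturbation =
  fixes z :: complex and \<beta> \<epsilon> :: "nat \<Rightarrow> complex" and \<kappa> :: "nat \<Rightarrow> real"
  assumes z: "z \<noteq> 0" "cmod z < 1"
    and kernel: "\<And>n m. cmod (free_kernel z n m) \<le> \<kappa> m"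
    and zero: "\<beta> 0 = 0" "\<epsilon> 0 = 0"
    and summable: "summable (\<lambda>m. cmod (\<beta> m) + cmod (\<epsilon> m))"
    and weighted: "summable (\<lambda>m. \<kappa> m * (cmod (\<beta> m) + cmod (\<epsilon> m)))"
    and small: "(\<Sum>m. \<kappa> m * (cmod (\<beta> m) + cmod (\<epsilon> m))) < 1"
begin

definition W :: "nat \<Rightarrow> real" where
  "W m = cmod (\<beta> m) + cmod (\<epsilon> m)"

definition V :: "(nat \<Rightarrow> complex) \<Rightarrow> nat \<Rightarrow> complex" where
  "V x m = \<beta> m * x m + \<epsilon> m * x (Suc m)"

definition S :: real where
  "S = (\<Sum>m. \<kappa> m * W m)"

lemma summable_W: "summable W" and weighted_W: "summable (\<lambda>m. \<kappa> m * W m)"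
  using summable weighted by (simp_all add: W_def[abs_def])

lemma W_nonneg: "0 \<le> W m"
  by (simp add: W_def)

lemma W_le: "W m \<le> suminf W"
  using sum_le_suminf[OF summable_W, of "{m}"] W_nonneg by simp

lemma kappa_nonneg: "0 \<le> \<kappa> m"
  using kernel[of 0 m] by simp

lemma S_bounds: "0 \<le> S" "S < 1"
  using suminf_nonneg[OF weighted_W] W_nonneg kappa_nonneg small by (auto simp: S_def W_def)

lemma V_0: "V x 0 = 0"
  by (simp add: V_def zero)

lemma V_diff: "V (\<lambda>n. x n - y n) m = V x m - V y m"
  by (simp add: V_def algebra_simps)

lemma cmod_V_le:
  assumes "\<And>n. cmod (x n) \<le> X"
  shows "cmod (V x m) \<le> W m * X"
proof -
  have "cmod (V x m) \<le> cmod (\<beta> m) * cmod (x m) + cmod (\<epsilon> m) * cmod (x (Suc m))"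
    unfolding V_def by (metis norm_mult norm_triangle_ineq)
  also have "\<dots> \<le> cmod (\<beta> m) * X + cmod (\<epsilon> m) * X"
    by (intro add_mono mult_left_mono assms) auto
  finally show ?thesis
    by (simp add: W_def algebra_simps)
qed

lemma cmod_V_bounded:
  assumes "\<And>n. cmod (x n) \<le> X"
  shows "cmod (V x m) \<le> suminf W * X"
proof -
  have "0 \<le> X"
    using assms[of 0] norm_ge_zero order_trans by blast
  then show ?thesis
    using cmod_V_le[of x X m, OF assms] mult_right_mono[OF W_le[of m]] by fastforce
qed

text \<open>Absolutely summable coefficients turn a bounded sequence into a summable one. This
  regains square summability after the work in the sup norm.\<close>

lemma V_ell2:
  assumes "\<And>n. cmod (x n) \<le> X"
  shows "V x \<in> ell2" "ell2_norm (V x) \<le> suminf W * X"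
proof -
  have sm: "summable (\<lambda>m. cmod (V x m))"
    by (rule summable_comparison_test'[OF summable_mult2[OF summable_W, of X]])
      (use cmod_V_le[OF assms] in auto)
  show "V x \<in> ell2"
    by (rule ell2_if_summable[of "V x", OF sm V_0])
  have "ell2_norm (V x) \<le> (\<Sum>m. cmod (V x m))"
    by (rule ell2_if_summable[of "V x", OF sm V_0])
  also have "\<dots> \<le> (\<Sum>m. W m * X)"
    by (rule suminf_le[OF cmod_V_le[OF assms] sm summable_mult2[OF summable_W]])
  also have "\<dots> = suminf W * X"
    by (rule suminf_mult2[OF summable_W, symmetric])
  finally show "ell2_norm (V x) \<le> suminf W * X" .
qed

text \<open>As \<open>\<kappa>\<close> bounds the kernel uniformly in n, the weighted sum
  \<open>S\<close> bounds the free resolvent composed with \<open>V\<close> in the sup norm. This is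
  the contraction constant.\<close>

lemma cmod_resolvent_V_le:
  assumes "\<And>n. cmod (x n) \<le> X"
  shows "cmod (free_resolvent z (V x) n) \<le> S * X"
proof -
  have le: "cmod (free_kernel z n m * V x m) \<le> \<kappa> m * W m * X" for m
    using mult_mono[OF kernel[of n m] cmod_V_le[of x X m, OF assms] kappa_nonneg norm_ge_zero]
    by (simp add: norm_mult mult.assoc)
  have sm: "summable (\<lambda>m. cmod (free_kernel z n m * V x m))"
    by (rule free_kernel_summable_bounded(1)[OF z(2) cmod_V_bounded[OF assms]])
  have "cmod (free_resolvent z (V x) n) \<le> (\<Sum>m. cmod (free_kernel z n m * V x m))"
    unfolding free_resolvent_def by (rule summable_norm[OF sm])
  also have "\<dots> \<le> (\<Sum>m. \<kappa> m * W m * X)"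
    by (rule suminf_le[OF le sm summable_mult2[OF weighted_W]])
  also have "\<dots> = S * X"
    unfolding S_def by (rule suminf_mult2[OF weighted_W, symmetric])
  finally show ?thesis .
qed

text \<open>The free resolvent of g - V x, as a map of x, has a bounded fixed point x. Since g - V x
  is in \<open>ell2\<close>, \<open>bounded_solution_ell2\<close> puts x there as well.\<close>

lemma perturbed_onto:
  assumes g: "g \<in> ell2"
  shows "\<exists>x\<in>ell2. \<forall>n. x (Suc (Suc n)) + x n - (z + inverse z) * x (Suc n) + V x (Suc n) = g (Suc n)"
proof -
  define f where "f x = (\<lambda>m. g m - V x m)" for x
  have f_bound: "cmod (f x m) \<le> ell2_norm g + suminf W * X" if "\<And>n. cmod (x n) \<le> X" for x m X
    unfolding f_def
    by (intro order_trans[OF norm_triangle_ineq4] add_mono cmod_le_ell2_norm g cmod_V_bounded that)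
  obtain x X where x: "free_resolvent z (f x) = x" and X: "\<And>n. cmod (x n) \<le> X"
  proof (rule bounded_contraction_fixpoint[of S "\<lambda>x. free_resolvent z (f x)"])
    show "\<exists>Y. \<forall>n. cmod (free_resolvent z (f x) n) \<le> Y" if "\<And>n. cmod (x n) \<le> X" for x X
      using free_kernel_summable_bounded(2)[of z "f x", OF z(2) f_bound[of x X, OF that]] by blast
    show "cmod (free_resolvent z (f x) n - free_resolvent z (f y) n) \<le> S * D"
      if "\<And>n. cmod (x n) \<le> X" "\<And>n. cmod (y n) \<le> Y" "\<And>n. cmod (x n - y n) \<le> D" for x y X Y D n
    proof -
      have "free_resolvent z (f x) n - free_resolvent z (f y) n = free_resolvent z (\<lambda>m. f x m - f y m) n"
        by (rule free_resolvent_diff[OF z(2) f_bound[OF that(1)] f_bound[OF that(2)], symmetric])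
      \<comment> \<open>The order is reversed because \<open>V\<close> enters \<open>f\<close> with
        a minus sign.\<close>
      also have "(\<lambda>m. f x m - f y m) = V (\<lambda>n. y n - x n)"
        by (auto simp: f_def V_diff)
      also have "cmod (free_resolvent z (V (\<lambda>n. y n - x n)) n) \<le> S * D"
        by (rule cmod_resolvent_V_le) (metis that(3) norm_minus_commute)
      finally show ?thesis .
    qed
  qed (use S_bounds in auto)
  have x0: "x 0 = 0"
    using fun_cong[OF x, of 0] by simp
  have eq: "x (Suc (Suc n)) + x n - (z + inverse z) * x (Suc n) = g (Suc n) - V x (Suc n)" for n
    using free_resolvent_eq[of z "f x", OF z f_bound[of x X, OF X], of n] unfolding x by (simp add: f_def)
  have "(\<lambda>n. g n - V x n) \<in> ell2"
    by (intro ell2_diff g V_ell2[OF X])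
  then have "x \<in> ell2"
    by (rule bounded_solution_ell2(1)[of z x X, OF z x0 X]) (rule eq)
  then show ?thesis
    using eq by (intro bexI[of _ x]) auto
qed

text \<open>The contraction is available in the sup norm, so the estimate passes through it: first
  the supremum of |x| is bounded by the norm of g, then the free estimate is applied to g - V
  x.\<close>

lemma perturbed_bounded_below:
  "\<exists>K\<ge>0. \<forall>x\<in>ell2. \<forall>g\<in>ell2.
    (\<forall>n. x (Suc (Suc n)) + x n - (z + inverse z) * x (Suc n) + V x (Suc n) = g (Suc n)) \<longrightarrow>
    ell2_norm x \<le> K * ell2_norm g"
proof -
  define K where "K = 1 / (1 - cmod z)\<^sup>2"
  have K: "0 \<le> K"
    by (simp add: K_def)
  have "ell2_norm x \<le> K * (1 + suminf W * (K / (1 - S))) * ell2_norm g"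
    if x: "x \<in> ell2" and g: "g \<in> ell2"
      and eq: "\<And>n. x (Suc (Suc n)) + x n - (z + inverse z) * x (Suc n) + V x (Suc n) = g (Suc n)"
    for x g
  proof -
    let ?f = "\<lambda>m. g m - V x m"
    have f: "?f \<in> ell2"
      by (intro ell2_diff g V_ell2[OF cmod_le_ell2_norm[OF x]])
    have eq': "x (Suc (Suc n)) + x n - (z + inverse z) * x (Suc n) = ?f (Suc n)" for n
      using eq[of n] by (simp add: algebra_simps)
    \<comment> \<open>Both sides are bounded solutions of the same free recurrence.\<close>
    have x_eq: "x = free_resolvent z ?f"
    proof (rule bounded_solution_unique[OF z])
      show "cmod (x n) \<le> ell2_norm x" for n
        by (rule cmod_le_ell2_norm[OF x])
      show "cmod (free_resolvent z ?f n) \<le>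
          2 / cmod (z - inverse z) * ell2_norm ?f * (2 / (1 - cmod z))" for n
        by (rule free_kernel_summable_bounded(2)[OF z(2) cmod_le_ell2_norm[OF f]])
      show "x (Suc (Suc n)) + x n - (z + inverse z) * x (Suc n) =
          free_resolvent z ?f (Suc (Suc n)) + free_resolvent z ?f n
          - (z + inverse z) * free_resolvent z ?f (Suc n)" for n
        unfolding free_resolvent_eq[OF z cmod_le_ell2_norm[OF f]] by (rule eq')
    qed (use ell2_zero[OF x] in auto)
    have Rg: "free_resolvent z g \<in> ell2" "ell2_norm (free_resolvent z g) \<le> K * ell2_norm g"
      unfolding K_def
      by (rule bounded_solution_ell2[OF z _ free_kernel_summable_bounded(2)[OF z(2) cmod_le_ell2_norm[OF g]] g
            free_resolvent_eq[OF z cmod_le_ell2_norm[OF g]]]; simp)+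
    define X where "X = (SUP n. cmod (x n))"
    have x_le: "cmod (x n) \<le> X" for n
      unfolding X_def by (rule cSUP_upper) (auto intro: bdd_aboveI2 cmod_le_ell2_norm[OF x])
    have "X \<le> K * ell2_norm g + S * X"
      unfolding X_def
    proof (rule cSUP_least)
      fix n
      have "x n = free_resolvent z g n - free_resolvent z (V x) n"
        using fun_cong[OF x_eq, of n]
          free_resolvent_diff[OF z(2) cmod_le_ell2_norm[OF g] cmod_V_bounded[OF x_le]] by simp
      then have "cmod (x n) \<le> cmod (free_resolvent z g n) + cmod (free_resolvent z (V x) n)"
        by (metis norm_triangle_ineq4)
      also have "\<dots> \<le> K * ell2_norm g + S * X"
        by (intro add_mono order_trans[OF cmod_le_ell2_norm Rg(2)] Rg cmod_resolvent_V_le x_le)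
      finally show "cmod (x n) \<le> K * ell2_norm g + S * (SUP n. cmod (x n))"
        by (simp add: X_def)
    qed simp
    \<comment> \<open>The supremum \<open>X\<close> is finite, so S < 1 allows the term S X to be
      absorbed on the left.\<close>
    then have X_le: "X \<le> K / (1 - S) * ell2_norm g"
      using S_bounds by (simp add: field_simps)
    have "ell2_norm x \<le> K * ell2_norm ?f"
      unfolding K_def
      by (rule bounded_solution_ell2(2)[OF z _ x_le f eq']) (rule ell2_zero[OF x])
    also have "\<dots> \<le> K * (ell2_norm g + suminf W * X)"
      by (intro mult_left_mono K order_trans[OF ell2_diff(2)] add_left_mono V_ell2[OF x_le] g)
    also have "\<dots> \<le> K * (ell2_norm g + suminf W * (K / (1 - S) * ell2_norm g))"
      using suminf_nonneg[OF summable_W W_nonneg]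
      by (intro mult_left_mono K add_left_mono X_le) auto
    finally show ?thesis
      by (simp add: algebra_simps)
  qed
  moreover have "0 \<le> K * (1 + suminf W * (K / (1 - S)))"
    using K S_bounds suminf_nonneg[OF summable_W W_nonneg]
    by (intro mult_nonneg_nonneg add_nonneg_nonneg) auto
  ultimately show ?thesis
    by blast
qed

end

section \<open>Points off [-2, 2] as values of z + 1/z on the disc\<close>

text \<open>The roots of u^2 - w u + 1 are mutually inverse, so one lies in the open disc unless
  both have modulus 1. In that case w = u + \<open>cnj u\<close> = 2 Re u would lie in
  [-2, 2].\<close>

lemma joukowski_preimage:
  fixes w :: complex
  assumes "w \<notin> complex_of_real ` {-2..2}"
  obtains z where "z \<noteq> 0" "cmod z < 1" "w = z + inverse z"
proof -
  define q where "q = csqrt (w\<^sup>2 - 4)"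
  define u where "u = (w + q) / 2"
  have "u * ((w - q) / 2) = (w\<^sup>2 - q\<^sup>2) / 4"
    by (simp add: u_def field_simps power2_eq_square)
  also have "\<dots> = 1"
    by (simp add: q_def)
  finally have uv: "u * ((w - q) / 2) = 1" .
  then have u0: "u \<noteq> 0"
    by auto
  have inv: "inverse u = (w - q) / 2"
    using uv by (rule inverse_unique)
  have w: "w = u + inverse u"
    unfolding inv by (simp add: u_def field_simps)
  consider "cmod u < 1" | "cmod u > 1" | "cmod u = 1"
    by linarith
  then show thesis
  proof cases
    case 1
    then show ?thesis using that u0 w by blast
  next
    case 2
    then have "cmod (inverse u) < 1"
      by (simp add: norm_inverse inverse_less_1_iff)
    then show ?thesis
      using that[of "inverse u"] u0 w by (simp add: add.commute)
  next
    case 3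
    then have "inverse u = cnj u"
      using u0 by (simp add: complex_eq_iff inverse_complex.sel cmod_def)
    then have "w = complex_of_real (2 * Re u)"
      using w complex_add_cnj by metis
    moreover have "\<bar>Re u\<bar> \<le> 1"
      using abs_Re_le_cmod[of u] 3 by simp
    ultimately have "w \<in> complex_of_real ` {-2..2}"
      by (intro image_eqI[where x = "2 * Re u"]) auto
    then show ?thesis using assms by blast
  qed
qed

section \<open>The Jacobi operator on \<open>ell2\<close> and its diagonal conjugation\<close>

lemma ell2_shift_left:
  assumes "y \<in> ell2"
  shows "(\<lambda>n. if n = 0 then 0 else y (Suc n)) \<in> ell2"
proof -
  have "summable (\<lambda>n. (cmod (y (Suc n)))\<^sup>2)"
    using assms by (subst summable_Suc_iff) (simp add: ell2_def)
  then show ?thesis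
    unfolding ell2_def by (auto intro: summable_comparison_test'[where N=0])
qed

lemma ell2_shift_right:
  assumes "y \<in> ell2"
  shows "(\<lambda>n. y (n - 1)) \<in> ell2"
proof -
  have "summable (\<lambda>n. (cmod (y (Suc n - 1)))\<^sup>2)"
    using assms by (simp add: ell2_def)
  then show ?thesis
    using assms unfolding ell2_def by (subst (asm) summable_Suc_iff) simp
qed

text \<open>Because 0 - 1 = 0 on naturals and y 0 = 0, one formula covers the first row and the
  padding index 0. Only the superdiagonal term has to be switched off at 0, where y 1 would
  enter.\<close>

lemma jacobi_eq:
  assumes "y 0 = 0"
  shows "jacobi a b c y = (\<lambda>m. a (m - 1) * y (m - 1) + b m * y m
      + c m * (if m = 0 then 0 else y (Suc m)))"
  using assms by (auto simp: jacobi_def fun_eq_iff numeral_2_eq_2)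

lemma jacobi_ell2:
  assumes y: "y \<in> ell2" and "Bseq a" "Bseq b" "Bseq c"
  shows "jacobi a b c y \<in> ell2"
proof -
  obtain A B C where "\<And>n. cmod (a n) \<le> A" "\<And>n. cmod (b n) \<le> B" "\<And>n. cmod (c n) \<le> C"
    using assms(2-4) unfolding Bseq_def by metis
  then show ?thesis
    unfolding jacobi_eq[of y, OF ell2_zero[OF y]]
    using ell2_mult_bounded(1)[OF ell2_shift_right[OF y], of "\<lambda>n. a (n - 1)" A]
      ell2_mult_bounded(1)[OF y, of b B]
      ell2_mult_bounded(1)[OF ell2_shift_left[OF y], of c C]
    by (intro ell2_add) auto
qed

lemma jacobi_add: "jacobi a b c (\<lambda>n. x n + y n) = (\<lambda>n. jacobi a b c x n + jacobi a b c y n)"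
  by (auto simp: jacobi_def fun_eq_iff algebra_simps)

lemma jacobi_mult: "jacobi a b c (\<lambda>n. k * y n) = (\<lambda>n. k * jacobi a b c y n)"
  by (auto simp: jacobi_def fun_eq_iff algebra_simps)

text \<open>The recursion for \<open>\<delta>\<close> normalises the subdiagonal to 1 and moves each
  factor \<open>a\<close> to the superdiagonal, so that only the products of \<open>a\<close> and
  \<open>c\<close> remain.\<close>

lemma jacobi_conjugate:
  assumes "x 0 = 0" "\<And>n. \<delta> (Suc n) = a n * \<delta> n"
  shows "jacobi a b c (\<lambda>n. \<delta> n * x n) (Suc n) =
    \<delta> (Suc n) * (x n + b (Suc n) * x (Suc n) + a (Suc n) * c (Suc n) * x (Suc (Suc n)))"
  using assms by (simp add: jacobi_eq[where y = "\<lambda>n. \<delta> n * x n"] algebra_simps)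

lemma partial_products_bounded:
  fixes a :: "nat \<Rightarrow> complex"
  assumes "\<And>n. a n \<noteq> 0" "convergent_prod (\<lambda>i. a (Suc i))"
  obtains K where "\<And>n. cmod (\<Prod>i<n. a i) \<le> K" "\<And>n. cmod (inverse (\<Prod>i<n. a i)) \<le> K"
proof -
  let ?p = "\<lambda>n. \<Prod>i<n. a i"
  obtain l where l: "(\<lambda>n. \<Prod>i\<le>n. a (Suc i)) \<longlonglongrightarrow> l" "l \<noteq> 0"
    using assms convergent_prod_iff_nz_lim[of "\<lambda>i. a (Suc i)"] by blast
  \<comment> \<open>The convergent product starts at index 1 and includes its upper end, whereas
    \<open>?p\<close> starts at 0 and excludes it; hence the double shift and the factor
    \<open>a 0\<close>.\<close>
  have "?p (Suc (Suc n)) = a 0 * (\<Prod>i\<le>n. a (Suc i))" for n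
    by (subst prod.lessThan_Suc_shift) (simp only: lessThan_Suc_atMost)
  then have "(\<lambda>n. ?p (Suc (Suc n))) \<longlonglongrightarrow> a 0 * l"
    using tendsto_mult_left[OF l(1)] by simp
  then have L: "?p \<longlonglongrightarrow> a 0 * l"
    by (rule LIMSEQ_imp_Suc[of ?p, OF LIMSEQ_imp_Suc[of "\<lambda>n. ?p (Suc n)"]])
  have nz: "a 0 * l \<noteq> 0"
    using l(2) assms(1) by simp
  have "Bseq ?p" "Bseq (\<lambda>n. inverse (?p n))"
    using L tendsto_inverse[OF L nz] convergent_imp_Bseq convergentI by blast+
  then obtain A B where "\<And>n. cmod (?p n) \<le> A" "\<And>n. cmod (inverse (?p n)) \<le> B"
    unfolding Bseq_def by metis
  then show thesis
    by (intro that[of "max A B"]) (meson max.coboundedI1 max.coboundedI2)+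
qed

section \<open>Points in the resolvent set of the Jacobi matrix\<close>

text \<open>Row m of the perturbation contains \<open>a m * c m - 1\<close>, whereas
  \<open>jacobi_d\<close> pairs that term with \<open>b (m + 1)\<close>. Monotonicity of
  \<open>\<kappa>\<close> absorbs this shift of index.\<close>

lemma jacobi_resolvent_set:
  fixes a b c :: "nat \<Rightarrow> complex"
  assumes a: "\<And>n. a n \<noteq> 0" "convergent_prod (\<lambda>i. a (Suc i))"
    and bounded: "Bseq a" "Bseq b" "Bseq c"
    and one: "a 0 = 1" "c 0 = 1"
    and z: "z \<noteq> 0" "cmod z < 1"
    and kernel: "\<And>n m. cmod (free_kernel z n m) \<le> \<kappa> m"
    and mono: "incseq \<kappa>"
    and d: "summable (\<lambda>m. jacobi_d a b c (Suc m))"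
    and \<kappa>d: "summable (\<lambda>m. \<kappa> (Suc m) * jacobi_d a b c (Suc m))"
      "(\<Sum>m. \<kappa> (Suc m) * jacobi_d a b c (Suc m)) < 1"
  shows "z + inverse z \<notin> ell2_spectrum (jacobi a b c)"
proof -
  \<comment> \<open>The value \<open>b 0\<close> is arbitrary and is replaced by 0;
    \<open>\<epsilon>\<close> vanishes at 0 because \<open>a 0 = c 0 = 1\<close>.\<close>
  define \<beta> where "\<beta> m = (if m = 0 then 0 else b m)" for m
  define \<epsilon> where "\<epsilon> m = a m * c m - 1" for m
  have \<kappa>: "0 \<le> \<kappa> m" for m
    using kernel[of 0 m] by simp
  have d_eq: "jacobi_d a b c (Suc m) = cmod (\<beta> (Suc m)) + cmod (\<epsilon> m)" for m
    by (simp add: jacobi_d_def \<beta>_def \<epsilon>_def norm_minus_commute)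
  \<comment> \<open>Stated for a general weight since it is applied to \<open>\<kappa>\<close> and
    to the constant 1.\<close>
  have weights: "summable (\<lambda>m. k m * (cmod (\<beta> m) + cmod (\<epsilon> m))) \<and>
      (\<Sum>m. k m * (cmod (\<beta> m) + cmod (\<epsilon> m))) \<le> (\<Sum>m. k (Suc m) * jacobi_d a b c (Suc m))"
    if k: "\<And>m. 0 \<le> k m" "incseq k" "summable (\<lambda>m. k (Suc m) * jacobi_d a b c (Suc m))" for k :: "nat \<Rightarrow> real"
  proof -
    have k_le: "k m \<le> k (Suc m)" for m
      using k(2) by (simp add: incseq_SucD)
    have s\<beta>: "summable (\<lambda>m. k (Suc m) * cmod (\<beta> (Suc m)))"
      and s\<epsilon>: "summable (\<lambda>m. k (Suc m) * cmod (\<epsilon> m))"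
      by (rule summable_comparison_test'[OF k(3), of 0]; use k(1) in \<open>simp add: d_eq mult_left_mono\<close>)+
    have s\<beta>': "summable (\<lambda>m. k m * cmod (\<beta> m))"
      using s\<beta> by (subst (asm) summable_Suc_iff)
    have s\<epsilon>': "summable (\<lambda>m. k m * cmod (\<epsilon> m))"
      by (rule summable_comparison_test'[OF s\<epsilon>, of 0]) (use k(1) k_le in \<open>simp add: mult_right_mono\<close>)
    have "(\<Sum>m. k m * (cmod (\<beta> m) + cmod (\<epsilon> m))) = (\<Sum>m. k m * cmod (\<beta> m)) + (\<Sum>m. k m * cmod (\<epsilon> m))"
      using suminf_add[OF s\<beta>' s\<epsilon>'] by (simp add: distrib_left)
    also have "(\<Sum>m. k m * cmod (\<beta> m)) = (\<Sum>m. k (Suc m) * cmod (\<beta> (Suc m)))"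
      using suminf_split_head[OF s\<beta>'] by (simp add: \<beta>_def)
    also have "(\<Sum>m. k m * cmod (\<epsilon> m)) \<le> (\<Sum>m. k (Suc m) * cmod (\<epsilon> m))"
      by (rule suminf_le[OF _ s\<epsilon>' s\<epsilon>]) (simp add: k_le mult_right_mono)
    also have "(\<Sum>m. k (Suc m) * cmod (\<beta> (Suc m))) + (\<Sum>m. k (Suc m) * cmod (\<epsilon> m)) =
        (\<Sum>m. k (Suc m) * jacobi_d a b c (Suc m))"
      using suminf_add[OF s\<beta> s\<epsilon>] by (simp add: d_eq distrib_left)
    finally show ?thesis
      using summable_add[OF s\<beta>' s\<epsilon>'] by (simp add: distrib_left)
  qed
  interpret small_perturbation z \<beta> \<epsilon> \<kappa>
    using weights[of \<kappa>] weights[of "\<lambda>_. 1"] \<kappa> mono d \<kappa>d z kernel one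
    by unfold_locales (auto simp: \<beta>_def \<epsilon>_def incseq_def)
  define \<delta> where "\<delta> n = (\<Prod>i<n. a i)" for n
  obtain M where M: "\<And>n. cmod (\<delta> n) \<le> M" "\<And>n. cmod (inverse (\<delta> n)) \<le> M"
    using partial_products_bounded[OF a] unfolding \<delta>_def by blast
  have M0: "0 \<le> M"
    using M(1)[of 0] norm_ge_zero order_trans by blast
  have \<delta>0: "\<delta> n \<noteq> 0" for n
    using a by (simp add: \<delta>_def)
  have \<delta>_Suc: "\<delta> (Suc n) = a n * \<delta> n" for n
    by (simp add: \<delta>_def)
  let ?D = "\<lambda>y n. jacobi a b c y n - (z + inverse z) * y n"
  have D_eq: "?D (\<lambda>n. \<delta> n * x n) (Suc n) =
      \<delta> (Suc n) * (x (Suc (Suc n)) + x n - (z + inverse z) * x (Suc n) + V x (Suc n))"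
    if "x 0 = 0" for x n
    unfolding jacobi_conjugate[of x \<delta> a, OF that \<delta>_Suc] by (simp add: V_def \<beta>_def \<epsilon>_def algebra_simps)
  obtain K where K: "0 \<le> K" and below: "\<And>x g. \<lbrakk>x \<in> ell2; g \<in> ell2;
      \<And>n. x (Suc (Suc n)) + x n - (z + inverse z) * x (Suc n) + V x (Suc n) = g (Suc n)\<rbrakk>
      \<Longrightarrow> ell2_norm x \<le> K * ell2_norm g"
    using perturbed_bounded_below by blast
  show ?thesis
  proof (rule not_in_ell2_spectrumI)
    fix y assume y: "y \<in> ell2"
    \<comment> \<open>Division by \<open>\<delta>\<close> leads to the conjugated equation. Passing
      there and back costs a factor \<open>M\<close> each, hence the constant
      \<open>M * K * M\<close>.\<close>
    let ?x = "\<lambda>n. inverse (\<delta> n) * y n" and ?g = "\<lambda>n. inverse (\<delta> n) * ?D y n"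
    have x: "?x \<in> ell2"
      by (rule ell2_mult_bounded(1)[of y "\<lambda>n. inverse (\<delta> n)", OF y M(2)])
    have yx: "\<delta> k * ?x k = y k" for k
      using \<delta>0 by simp
    have cancel: "p = inverse d * q" if "d \<noteq> 0" "q = d * p" for p q d :: complex
      using that by simp
    have x0: "?x 0 = 0"
      using ell2_zero[OF y] by simp
    have Dy: "?D y \<in> ell2"
      by (intro ell2_diff jacobi_ell2 y bounded ell2_mult_bounded(1)[OF y, of "\<lambda>_. z + inverse z"]) auto
    then have g: "?g \<in> ell2" "ell2_norm ?g \<le> M * ell2_norm (?D y)"
      by (rule ell2_mult_bounded[of "?D y" "\<lambda>n. inverse (\<delta> n)", OF _ M(2)])+
    have "?x (Suc (Suc n)) + ?x n - (z + inverse z) * ?x (Suc n) + V ?x (Suc n) = ?g (Suc n)" for n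
      using D_eq[of ?x, OF x0, of n] unfolding yx by (rule cancel[OF \<delta>0])
    then have x_le: "ell2_norm ?x \<le> K * ell2_norm ?g"
      by (rule below[of ?x ?g, OF x g(1)])
    have "ell2_norm y \<le> M * ell2_norm ?x"
      using ell2_mult_bounded(2)[of ?x \<delta> M, OF x M(1)] unfolding yx .
    also have "\<dots> \<le> M * (K * (M * ell2_norm (?D y)))"
      by (intro mult_left_mono M0 order_trans[OF x_le mult_left_mono[OF g(2) K]])
    finally show "ell2_norm y \<le> M * K * M * ell2_norm (?D y)"
      by (simp add: mult.assoc)
  next
    fix g assume g: "g \<in> ell2"
    then have "(\<lambda>n. inverse (\<delta> n) * g n) \<in> ell2"
      by (rule ell2_mult_bounded(1)[of g "\<lambda>n. inverse (\<delta> n)", OF _ M(2)])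
    from perturbed_onto[OF this] obtain x where x: "x \<in> ell2"
      and eq: "\<And>n. x (Suc (Suc n)) + x n - (z + inverse z) * x (Suc n) + V x (Suc n) =
        inverse (\<delta> (Suc n)) * g (Suc n)"
      by blast
    have "?D (\<lambda>n. \<delta> n * x n) n = g n" for n
    proof (cases n)
      case 0
      then show ?thesis
        using ell2_zero[OF x] ell2_zero[OF g] by (simp add: jacobi_def)
    next
      case (Suc k)
      then show ?thesis
        unfolding Suc D_eq[of x, OF ell2_zero[OF x]] eq using \<delta>0[of "Suc k"] by simp
    qed
    then show "\<exists>y\<in>ell2. ?D y = g"
      using ell2_mult_bounded(1)[of x \<delta> M, OF x M(1)] by blast
  qed (auto intro: jacobi_ell2 bounded simp: jacobi_add jacobi_mult)
qed

section \<open>Regions free of discrete spectrum\<close>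

theorem theorem2:
  fixes a b c :: "nat \<Rightarrow> complex" and t :: real
  assumes "\<And>n. n \<ge> 1 \<Longrightarrow> a n * c n \<noteq> 0"
    and "a \<longlonglongrightarrow> 1" and "c \<longlonglongrightarrow> 1" and "b \<longlonglongrightarrow> 0"
    and "convergent_prod (\<lambda>i. a (Suc i))"
    and "a 0 = 1" and "c 0 = 1"
    and "t * exp t = 1"
  shows "(summable (\<lambda>m. jacobi_d a b c (Suc m)) \<longrightarrow>
            jacobi_G t a b c \<inter> jacobi_discrete_spectrum a b c = {}) \<and>
         (summable (\<lambda>m. real (Suc m) * jacobi_d a b c (Suc m)) \<and>
          (\<Sum>m. real (Suc m) * jacobi_d a b c (Suc m)) < t \<longrightarrow>
            jacobi_discrete_spectrum a b c = {})"
proof -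
  have t0: "0 < t"
    using assms(8) by (metis exp_gt_zero zero_less_mult_pos2 zero_less_one)
  \<comment> \<open>Hence each hypothesis involving t gives a weighted sum of the \<open>d\<close>
    below 1.\<close>
  have t1: "t < 1"
  proof (rule ccontr)
    assume "\<not> t < 1"
    then have "1 * 1 < t * exp t"
      by (intro mult_le_less_imp_less) auto
    then show False
      using assms(8) by simp
  qed
  have a0: "a n \<noteq> 0" for n
    using assms(1)[of n] assms(6) by (cases n) auto
  have bounded: "Bseq a" "Bseq b" "Bseq c"
    using assms(2-4) convergent_imp_Bseq convergentI by blast+
  let ?d = "\<lambda>m. jacobi_d a b c (Suc m)"
  have d0: "0 \<le> ?d m" for m
    by (simp add: jacobi_d_def)
  note resolvent = jacobi_resolvent_set[OF a0 assms(5) bounded assms(6,7)]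
  have "jacobi_G t a b c \<inter> jacobi_discrete_spectrum a b c = {}" if d: "summable ?d"
  proof -
    have "z + inverse z \<notin> ell2_spectrum (jacobi a b c)" if "z \<in> jacobi_Omega t a b c" for z
    proof -
      have z: "z \<noteq> 0" "cmod z < 1" and large: "2 * inverse t * (\<Sum>m. ?d m) < cmod (z - inverse z)"
        using that by (auto simp: jacobi_Omega_def)
      have nz: "0 < cmod (z - inverse z)"
        using inverse_diff_nonzero[OF z] by simp
      have "2 * (\<Sum>m. ?d m) < cmod (z - inverse z) * t"
        using large t0 by (simp add: field_simps)
      also have "\<dots> \<le> cmod (z - inverse z) * 1"
        using t1 by (intro mult_left_mono) auto
      finally have "2 / cmod (z - inverse z) * (\<Sum>m. ?d m) < 1"
        using nz by (simp add: field_simps)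
      then have "(\<Sum>m. 2 / cmod (z - inverse z) * ?d m) < 1"
        unfolding suminf_mult[OF d] .
      then show ?thesis
        by (intro resolvent[of z "\<lambda>_. 2 / cmod (z - inverse z)"] z d cmod_free_kernel_le
            summable_mult) (auto simp: incseq_def)
    qed
    then show ?thesis
      by (auto simp: jacobi_G_def jacobi_discrete_spectrum_def)
  qed
  moreover have "jacobi_discrete_spectrum a b c = {}"
    if md: "summable (\<lambda>m. real (Suc m) * ?d m)" "(\<Sum>m. real (Suc m) * ?d m) < t"
  proof -
    \<comment> \<open>All weights m are at least 1, so the unweighted series converges too.\<close>
    have d: "summable ?d"
    proof (rule summable_comparison_test'[OF md(1), of 0])
      show "norm (?d m) \<le> real (Suc m) * ?d m" for m
        using mult_right_mono[of 1 "real (Suc m)" "?d m"] d0[of m] by simp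
    qed
    have "w \<notin> ell2_spectrum (jacobi a b c)" if w: "w \<notin> complex_of_real ` {-2..2}" for w
    proof -
      \<comment> \<open>The kernel bound m holds throughout the punctured disc, whose image under z
        + 1/z contains every point off [-2, 2].\<close>
      obtain z where z: "z \<noteq> 0" "cmod z < 1" "w = z + inverse z"
        using joukowski_preimage[OF w] .
      show ?thesis
        unfolding z(3)
        by (rule resolvent[of z real, OF z(1,2) cmod_free_kernel_le_index[OF z(1,2)] _ d md(1)])
          (use md(2) t1 in \<open>auto simp: incseq_def\<close>)
    qed
    then show ?thesis
      by (auto simp: jacobi_discrete_spectrum_def)
  qed
  ultimately show ?thesis by blast
qed

end
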